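(* Let $\nu=2\tan^{-1}(\tfrac12)=\tan^{-1}(\tfrac43)$, $T=R_x^{\nu}$ and $S=R_y^{\pi/2}$. The group $G(\nu,4,1)\subset SO(3)$ generated by $T$ and $S$ has the presentation $$\langle\alpha,\beta:\beta^4,\ \beta^2\alpha\beta^2\alpha\rangle,$$ with the identification $\alpha\mapsto T$, $\beta\mapsto S$.
   Context: $R_x^{\theta}, R_y^{\theta}\in SO(3)$ denote the rotations of Euclidean 3-space by angle $\theta$ (right-hand rule) about the $x$- and $y$-axis. In a presentation $\langle\text{generators}:\text{relators}\rangle$ each listed relator is set equal to the identity. *)

theory Defs
  imports "HOL-Analysis.Analysis" "HOL-Algebra.Elementary_Groups"
begin

text \<open>The free group on the elements of the type \<open>'a\<close>: words in the letters \<open>x\<close>, \<open>x\<inverse>\<close>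
  modulo insertion and deletion of adjacent mutually inverse letters.\<close>

datatype 'a letter = Pos 'a | Neg 'a

fun inv_letter :: "'a letter \<Rightarrow> 'a letter" where
  "inv_letter (Pos x) = Neg x"
| "inv_letter (Neg x) = Pos x"

inductive free_eq :: "'a letter list \<Rightarrow> 'a letter list \<Rightarrow> bool" where
  refl: "free_eq u u"
| sym: "free_eq u v \<Longrightarrow> free_eq v u"
| trans: "free_eq u v \<Longrightarrow> free_eq v w \<Longrightarrow> free_eq u w"
| cancel: "free_eq (u @ [x, inv_letter x] @ v) (u @ v)"

definition word_class :: "'a letter list \<Rightarrow> 'a letter list set" where
  "word_class w = {v. free_eq w v}"

definition free_group :: "'a letter list set monoid" where
  "free_group =
    \<lparr>carrier = range word_class,
     monoid.mult = (\<lambda>A B. \<Union>u\<in>A. \<Union>v\<in>B. word_class (u @ v)),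
     one = word_class []\<rparr>"

definition free_gen :: "'a \<Rightarrow> 'a letter list set" where
  "free_gen x = word_class [Pos x]"

definition normal_closure :: "('g, 'm) monoid_scheme \<Rightarrow> 'g set \<Rightarrow> 'g set" where
  "normal_closure G R = \<Inter>{N. N \<lhd> G \<and> R \<subseteq> N}"

definition presented_group :: "'a letter list set set \<Rightarrow> 'a letter list set set monoid" where
  "presented_group R = free_group Mod normal_closure free_group R"

definition presented_gen :: "'a letter list set set \<Rightarrow> 'a \<Rightarrow> 'a letter list set set" where
  "presented_gen R x = normal_closure free_group R #>\<^bsub>free_group\<^esub> free_gen x"

lemma word_class_eq_iff: "word_class u = word_class v \<longleftrightarrow> free_eq u v"
  unfolding word_class_def set_eq_iff mem_Collect_eq
  by (metis free_eq.refl free_eq.sym free_eq.trans)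

lemma free_eq_append:
  assumes "free_eq u u'" "free_eq v v'"
  shows "free_eq (u @ v) (u' @ v')"
proof -
  have "free_eq (u @ v) (u' @ v)"
    using assms(1)
  proof induction
    case (cancel u x w)
    show ?case using free_eq.cancel[of u x "w @ v"] by simp
  qed (fact free_eq.refl, erule free_eq.sym, erule (1) free_eq.trans)
  moreover have "free_eq (u' @ v) (u' @ v')"
    using assms(2)
  proof induction
    case (cancel w x v)
    show ?case using free_eq.cancel[of "u' @ w" x v] by simp
  qed (fact free_eq.refl, erule free_eq.sym, erule (1) free_eq.trans)
  ultimately show ?thesis by (rule free_eq.trans)
qed

lemma free_group_mult:
  "word_class u \<otimes>\<^bsub>free_group\<^esub> word_class v = word_class (u @ v)"
proof -
  have "word_class (u' @ v') = word_class (u @ v)"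
    if "u' \<in> word_class u" "v' \<in> word_class v" for u' v'
  proof -
    have "free_eq (u @ v) (u' @ v')"
      using that by (intro free_eq_append) (simp_all add: word_class_def)
    then show ?thesis
      by (simp add: word_class_eq_iff free_eq.sym)
  qed
  moreover have "u \<in> word_class u" "v \<in> word_class v"
    by (simp_all add: word_class_def free_eq.refl)
  ultimately have "(\<Union>u'\<in>word_class u. \<Union>v'\<in>word_class v. word_class (u' @ v')) = word_class (u @ v)"
    by (blast intro!: equalityI)
  then show ?thesis
    by (simp add: free_group_def)
qed

lemma free_group_inverse_word:
  "free_eq (map inv_letter (rev w) @ w) []"
proof (induction w)
  case Nil
  show ?case by (simp add: free_eq.refl)
next
  case (Cons x w)
  have "inv_letter (inv_letter x) = x"
    by (cases x) auto
  then have "free_eq (map inv_letter (rev (x # w)) @ x # w) (map inv_letter (rev w) @ w)"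
    using free_eq.cancel[of "map inv_letter (rev w)" "inv_letter x" w] by simp
  then show ?case using Cons by (rule free_eq.trans)
qed

lemma group_free_group: "group (free_group :: 'a letter list set monoid)"
proof (rule groupI)
  fix A B C :: "'a letter list set"
  assume "A \<in> carrier free_group"
  then obtain u where A: "A = word_class u" by (auto simp: free_group_def)
  show "\<exists>B\<in>carrier free_group. B \<otimes>\<^bsub>free_group\<^esub> A = \<one>\<^bsub>free_group\<^esub>"
  proof
    show "word_class (map inv_letter (rev u)) \<otimes>\<^bsub>free_group\<^esub> A = \<one>\<^bsub>free_group\<^esub>"
      unfolding A free_group_mult
      by (simp add: free_group_def word_class_eq_iff free_group_inverse_word)
  qed (simp add: free_group_def)
  show "\<one>\<^bsub>free_group\<^esub> \<otimes>\<^bsub>free_group\<^esub> A = A"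
  proof -
    have "\<one>\<^bsub>free_group\<^esub> = (word_class [] :: 'a letter list set)"
      by (simp add: free_group_def)
    then show ?thesis
      by (simp only: A free_group_mult append_Nil)
  qed
  assume "B \<in> carrier free_group"
  then obtain v where B: "B = word_class v" by (auto simp: free_group_def)
  show "A \<otimes>\<^bsub>free_group\<^esub> B \<in> carrier free_group"
    unfolding A B free_group_mult by (simp add: free_group_def)
  assume "C \<in> carrier free_group"
  then obtain w where C: "C = word_class w" by (auto simp: free_group_def)
  show "A \<otimes>\<^bsub>free_group\<^esub> B \<otimes>\<^bsub>free_group\<^esub> C = A \<otimes>\<^bsub>free_group\<^esub> (B \<otimes>\<^bsub>free_group\<^esub> C)"
    unfolding A B C free_group_mult by simp
qed (simp add: free_group_def)

text \<open>Matrices act on column vectors from the left.\<close>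

definition SO3 :: "(real^3^3) monoid" where
  "SO3 = \<lparr>carrier = {A. rotation_matrix A}, monoid.mult = (**), one = mat 1\<rparr>"

definition rot_x :: "real \<Rightarrow> real^3^3" where
  "rot_x \<theta> = vector [vector [1, 0, 0],
                     vector [0, cos \<theta>, - sin \<theta>],
                     vector [0, sin \<theta>, cos \<theta>]]"

definition rot_y :: "real \<Rightarrow> real^3^3" where
  "rot_y \<theta> = vector [vector [cos \<theta>, 0, sin \<theta>],
                     vector [0, 1, 0],
                     vector [- sin \<theta>, 0, cos \<theta>]]"

lemma rotation_matrix_rot_x: "rotation_matrix (rot_x \<theta>)"
  by (simp add: rotation_matrix_def rot_x_def orthogonal_matrix det_3 vec_eq_iff forall_3
      matrix_matrix_mult_def transpose_def mat_def sum_3 vector_3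
      flip: power2_eq_square)

lemma rotation_matrix_rot_y: "rotation_matrix (rot_y \<theta>)"
  by (simp add: rotation_matrix_def rot_y_def orthogonal_matrix det_3 vec_eq_iff forall_3
      matrix_matrix_mult_def transpose_def mat_def sum_3 vector_3
      flip: power2_eq_square)

lemma group_SO3: "group SO3"
proof (rule groupI)
  fix A assume "A \<in> carrier SO3"
  then have A: "orthogonal_matrix A" "det A = 1"
    by (auto simp: SO3_def rotation_matrix_def)
  then show "\<exists>B\<in>carrier SO3. B \<otimes>\<^bsub>SO3\<^esub> A = \<one>\<^bsub>SO3\<^esub>"
    by (intro bexI[of _ "transpose A"])
      (auto simp: SO3_def rotation_matrix_def orthogonal_matrix_def)
qed (auto simp: SO3_def rotation_matrix_def orthogonal_matrix_mul det_mul
      matrix_mul_assoc orthogonal_matrix_id)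

lemma two_arctan_half: "2 * arctan (1/2) = arctan (4/3)"
  using arctan_double[of "1/2"] by (simp add: power2_eq_square)

datatype gen = Alpha | Beta

definition relators :: "gen letter list set set" where
  "relators =
    (let a = free_gen Alpha; b = free_gen Beta in
      {b [^]\<^bsub>free_group\<^esub> (4::nat),
       b [^]\<^bsub>free_group\<^esub> (2::nat) \<otimes>\<^bsub>free_group\<^esub> a \<otimes>\<^bsub>free_group\<^esub>
         b [^]\<^bsub>free_group\<^esub> (2::nat) \<otimes>\<^bsub>free_group\<^esub> a})"

end

theory Submission
  imports Defs
begin

text \<open>In the presented group \<open>\<beta>\<^sup>2\<close> is an involution that inverts \<open>\<alpha>\<close>, so every element is
  \<open>u\<close> or \<open>u \<beta>\<^sup>2\<close> for a word \<open>u\<close> in \<open>\<alpha>\<close>, \<open>\<alpha>\<inverse>\<close>, \<open>\<beta>\<close> without the factors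
  \<open>\<alpha>\<alpha>\<inverse>\<close>, \<open>\<alpha>\<inverse>\<alpha>\<close>, \<open>\<beta>\<beta>\<close>. Since \<open>5 T\<close> and \<open>5 T\<inverse>\<close> are integral and \<open>S\<^sup>2\<close> fixes the
  \<open>y\<close>-axis, a word with \<open>n\<close> letters \<open>\<alpha>\<^sup>\<plusminus>\<^sup>1\<close> sends \<open>(0, 1, 0)\<close> to \<open>5\<^sup>-\<^sup>n\<close> times an integer vector,
  whose \<open>y\<close>-coordinate turns out to be nonzero modulo 5. Hence it is not the identity if \<open>n > 0\<close>,
  and for \<open>n = 0\<close> only a power of \<open>\<beta>\<close> of exponent at most 3 remains.\<close>

section \<open>Evaluation of words and presentations\<close>

primrec letter_eval :: "('g, 'm) monoid_scheme \<Rightarrow> ('a \<Rightarrow> 'g) \<Rightarrow> 'a letter \<Rightarrow> 'g" where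
  "letter_eval G f (Pos x) = f x"
| "letter_eval G f (Neg x) = inv\<^bsub>G\<^esub> (f x)"

primrec word_eval :: "('g, 'm) monoid_scheme \<Rightarrow> ('a \<Rightarrow> 'g) \<Rightarrow> 'a letter list \<Rightarrow> 'g" where
  "word_eval G f [] = \<one>\<^bsub>G\<^esub>"
| "word_eval G f (l # w) = letter_eval G f l \<otimes>\<^bsub>G\<^esub> word_eval G f w"

context group
begin

context
  fixes f :: "'i \<Rightarrow> 'a"
  assumes f: "f x \<in> carrier G"
begin

lemma letter_eval_closed: "letter_eval G f l \<in> carrier G"
  by (cases l) (simp_all add: f)

lemma word_eval_closed: "word_eval G f w \<in> carrier G"
  by (induction w) (simp_all add: letter_eval_closed)

lemma word_eval_append: "word_eval G f (u @ v) = word_eval G f u \<otimes> word_eval G f v"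
  by (induction u) (simp_all add: letter_eval_closed word_eval_closed m_assoc)

lemma letter_eval_inv_letter: "letter_eval G f (inv_letter l) = inv (letter_eval G f l)"
  by (cases l) (simp_all add: f)

lemma word_eval_free_eq: "free_eq u v \<Longrightarrow> word_eval G f u = word_eval G f v"
proof (induction rule: free_eq.induct)
  case (cancel u x v)
  have "letter_eval G f x \<otimes> (inv (letter_eval G f x) \<otimes> word_eval G f v) = word_eval G f v"
    by (simp add: letter_eval_closed word_eval_closed flip: m_assoc)
  then show ?case
    by (simp add: word_eval_append letter_eval_inv_letter)
qed simp_all

end

end

lemma hom_word_eval:
  assumes "group_hom G H h" and f: "\<And>x. f x \<in> carrier G"
  shows "h (word_eval G f w) = word_eval H (\<lambda>x. h (f x)) w"
proof -
  interpret group_hom G H h by fact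
  have "h (letter_eval G f l) = letter_eval H (\<lambda>x. h (f x)) l" for l
    by (cases l) (simp_all add: f)
  then show ?thesis
    by (induction w) (simp_all add: G.letter_eval_closed[of f] G.word_eval_closed[of f] f)
qed

section \<open>Homomorphisms out of free groups and the quotients by their kernels\<close>

lemma carrier_free_group: "carrier free_group = range word_class"
  by (simp add: free_group_def)

lemma word_class_closed: "word_class w \<in> carrier free_group"
  by (simp add: carrier_free_group)

lemma free_gen_closed: "free_gen x \<in> carrier free_group"
  by (simp add: free_gen_def word_class_closed)

lemma one_free_group: "\<one>\<^bsub>free_group\<^esub> = word_class []"
  by (simp add: free_group_def)

lemma word_eval_free_gen: "word_eval free_group free_gen w = word_class w"
proof (induction w)
  case Nil
  show ?case by (simp add: one_free_group)
next
  case (Cons l w)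
  have "inv\<^bsub>free_group\<^esub> (free_gen x) = word_class [Neg x]" for x :: 'a
    using free_eq.cancel[of "[]" "Neg x" "[]"]
    by (intro group.inv_equality[OF group_free_group])
      (simp_all add: free_gen_def free_group_mult word_class_eq_iff one_free_group word_class_closed)
  then have "letter_eval free_group free_gen l = word_class [l]"
    by (cases l) (simp_all add: free_gen_def)
  then show ?case
    by (simp add: Cons free_group_mult)
qed

text \<open>The chosen representative does not matter when \<open>f\<close> maps into a group: by
  \<open>word_eval_free_eq\<close>, evaluation is constant on word classes.\<close>

definition free_lift :: "('g, 'm) monoid_scheme \<Rightarrow> ('a \<Rightarrow> 'g) \<Rightarrow> 'a letter list set \<Rightarrow> 'g" where
  "free_lift G f A = word_eval G f (SOME w. w \<in> A)"

context
  fixes G :: "('g, 'm) monoid_scheme" and f :: "'a \<Rightarrow> 'g"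
  assumes G: "group G" and f: "f x \<in> carrier G"
begin

interpretation group G by (fact G)

lemma free_lift_word_class: "free_lift G f (word_class w) = word_eval G f w"
proof -
  have "(SOME v. v \<in> word_class w) \<in> word_class w"
    by (rule someI[of _ w]) (simp add: word_class_def free_eq.refl)
  then show ?thesis
    using word_eval_free_eq[of f] f by (simp add: free_lift_def word_class_def)
qed

lemma free_lift_free_gen: "free_lift G f (free_gen x) = f x"
  by (simp add: free_gen_def free_lift_word_class f)

lemma group_hom_free_lift: "group_hom free_group G (free_lift G f)"
proof -
  have "free_lift G f \<in> hom free_group G"
  proof (rule homI)
    fix A B :: "'a letter list set"
    assume "A \<in> carrier free_group"
    then obtain u where A: "A = word_class u" by (auto simp: carrier_free_group)
    show "free_lift G f A \<in> carrier G"
      by (simp add: A free_lift_word_class word_eval_closed f)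
    assume "B \<in> carrier free_group"
    then obtain v where B: "B = word_class v" by (auto simp: carrier_free_group)
    show "free_lift G f (A \<otimes>\<^bsub>free_group\<^esub> B) = free_lift G f A \<otimes>\<^bsub>G\<^esub> free_lift G f B"
      by (simp add: A B free_group_mult free_lift_word_class word_eval_append f)
  qed
  then show ?thesis
    by (simp add: group_hom_def group_hom_axioms_def group_free_group G)
qed

text \<open>The free group is generated by its free generators, and a homomorphism maps a generated
  subgroup onto the subgroup generated by the images.\<close>

lemma free_lift_image:
  "free_lift G f ` carrier free_group = carrier (subgroup_generated G (range f))"
proof -
  interpret F: group "free_group :: 'a letter list set monoid" by (fact group_free_group)
  interpret h: group_hom free_group G "free_lift G f" by (fact group_hom_free_lift)
  let ?F = "subgroup_generated free_group (range (free_gen :: 'a \<Rightarrow> _))"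
  have gen: "free_gen x \<in> carrier ?F" for x :: 'a
    using F.subgroup_generated_subset_carrier_subset[of "range free_gen"]
    by (auto simp: image_subset_iff free_gen_closed)
  have "word_class w \<in> carrier ?F" for w :: "'a letter list"
  proof -
    have "letter_eval ?F free_gen = letter_eval free_group (free_gen :: 'a \<Rightarrow> _)"
    proof
      show "letter_eval ?F free_gen l = letter_eval free_group free_gen l" for l :: "'a letter"
        by (cases l) (simp_all add: gen)
    qed
    then have "word_eval ?F free_gen w = word_class w"
      unfolding word_eval_free_gen[symmetric] by (induction w) simp_all
    then show ?thesis
      using group.word_eval_closed[of ?F free_gen w, OF F.group_subgroup_generated gen] by simp
  qed
  then have "carrier free_group \<subseteq> carrier ?F"
    by (simp add: carrier_free_group image_subset_iff)
  then have "carrier ?F = carrier free_group"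
    by (rule equalityI[OF F.carrier_subgroup_generated_subset])
  moreover have "free_lift G f ` range free_gen = range f"
    by (simp add: image_image free_lift_free_gen)
  moreover have "carrier (subgroup_generated G (free_lift G f ` range free_gen)) = free_lift G f ` carrier ?F"
    by (rule h.subgroup_generated_by_image) (auto simp: free_gen_closed)
  ultimately show ?thesis by simp
qed

text \<open>First isomorphism theorem: \<open>relator\<close> puts the normal closure inside the
  kernel of \<open>free_lift G f\<close>, and \<open>faithful\<close> gives the reverse
  inclusion.\<close>

theorem presentation_iso:
  assumes relator: "\<And>w. word_class w \<in> R \<Longrightarrow> word_eval G f w = \<one>\<^bsub>G\<^esub>"
    and R: "R \<subseteq> carrier free_group"
    and faithful: "\<And>w. word_eval G f w = \<one>\<^bsub>G\<^esub> \<Longrightarrow> word_class w \<in> normal_closure free_group R"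
  shows "\<exists>h \<in> iso (presented_group R) (subgroup_generated G (range f)). \<forall>x. h (presented_gen R x) = f x"
proof -
  let ?\<phi> = "free_lift G f" and ?H = "subgroup_generated G (range f)"
  interpret h: group_hom free_group G ?\<phi> by (fact group_hom_free_lift)
  have ker: "kernel free_group G ?\<phi> = normal_closure free_group R"
  proof
    show "kernel free_group G ?\<phi> \<subseteq> normal_closure free_group R"
      by (auto simp: kernel_def carrier_free_group free_lift_word_class faithful)
    have "R \<subseteq> kernel free_group G ?\<phi>"
      using R by (auto simp: kernel_def carrier_free_group free_lift_word_class relator)
    then show "normal_closure free_group R \<subseteq> kernel free_group G ?\<phi>"
      using h.normal_kernel by (auto simp: normal_closure_def)
  qed
  have "?\<phi> \<in> hom free_group ?H"
    using hom_into_subgroup_eq_gen[OF G] h.homh free_lift_image by blast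
  then interpret h': group_hom free_group ?H ?\<phi>
    by (simp add: group_hom_def group_hom_axioms_def)
  \<comment> \<open>Since \<open>?\<phi>\<close> is constant on each coset of its kernel, the image
    of a coset is a singleton.\<close>
  let ?h = "\<lambda>X. the_elem (?\<phi> ` X)"
  have "?h \<in> iso (presented_group R) ?H"
    using h'.FactGroup_iso_set free_lift_image by (simp add: presented_group_def ker)
  moreover have "?h (presented_gen R x) = f x" for x
  proof -
    have gen: "free_gen x \<in> presented_gen R x"
      unfolding presented_gen_def ker[symmetric]
      by (rule h.G.rcos_self[OF free_gen_closed h.subgroup_kernel])
    have const: "?\<phi> y = f x" if "y \<in> presented_gen R x" for y
      using that f unfolding presented_gen_def ker[symmetric]
      by (auto simp: r_coset_def kernel_def free_gen_closed free_lift_free_gen)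
    have "?h (presented_gen R x) = ?\<phi> (free_gen x)"
      by (rule the_elem_image_unique) (use gen in \<open>auto simp: const\<close>)
    then show ?thesis by (simp add: free_lift_free_gen)
  qed
  ultimately show ?thesis by (intro bexI[of _ ?h]) simp_all
qed

end

section \<open>Normal forms\<close>

text \<open>Conjugation by \<open>\<beta>\<^sup>2\<close> in the presented group, letter by
  letter.\<close>

fun flip_letter :: "gen letter \<Rightarrow> gen letter" where
  "flip_letter (Pos Alpha) = Neg Alpha"
| "flip_letter (Neg Alpha) = Pos Alpha"
| "flip_letter l = l"

text \<open>The pair \<open>(u, e)\<close> encodes the element \<open>u\<close> followed by \<open>\<beta>\<^sup>2\<close> if \<open>e\<close> holds.\<close>

definition nf_word :: "gen letter list \<times> bool \<Rightarrow> gen letter list" where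
  "nf_word p = fst p @ (if snd p then [Pos Beta, Pos Beta] else [])"

text \<open>Left multiplication by \<beta>. A square \<open>\<beta>\<beta>\<close> arising at the
  front is moved to the right end, flipping the letters it passes, and toggles the flag because
  \<open>\<beta>\<^sup>4 = 1\<close>.\<close>

fun nf_beta :: "gen letter list \<times> bool \<Rightarrow> gen letter list \<times> bool" where
  "nf_beta (Pos Beta # v, e) = (map flip_letter v, \<not> e)"
| "nf_beta (u, e) = (Pos Beta # u, e)"

text \<open>Left multiplication by one letter. The last clause multiplies first by
  \<open>\<beta>\<^sup>2\<close> and then by \<beta>, since \<open>\<beta>\<^sup>3\<close> is the
  inverse of \<beta>.\<close>

fun nf_cons :: "gen letter \<Rightarrow> gen letter list \<times> bool \<Rightarrow> gen letter list \<times> bool" where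
  "nf_cons (Pos Alpha) (Neg Alpha # v, e) = (v, e)"
| "nf_cons (Pos Alpha) (u, e) = (Pos Alpha # u, e)"
| "nf_cons (Neg Alpha) (Pos Alpha # v, e) = (v, e)"
| "nf_cons (Neg Alpha) (u, e) = (Neg Alpha # u, e)"
| "nf_cons (Pos Beta) (u, e) = nf_beta (u, e)"
| "nf_cons (Neg Beta) (u, e) = nf_beta (map flip_letter u, \<not> e)"

definition normal_form :: "gen letter list \<Rightarrow> gen letter list \<times> bool" where
  "normal_form w = foldr nf_cons w ([], False)"

definition reduced :: "gen letter list \<Rightarrow> bool" where
  "reduced u \<longleftrightarrow> Neg Beta \<notin> set u \<and>
     successively (\<lambda>l m. m \<noteq> (if l = Pos Beta then Pos Beta else inv_letter l)) u"

lemma letter_cases: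
  obtains "l = Pos Alpha" | "l = Neg Alpha" | "l = Pos Beta" | "l = Neg Beta"
  by (metis gen.exhaust letter.exhaust)

lemma reduced_Cons:
  "reduced (l # u) \<longleftrightarrow> l \<noteq> Neg Beta \<and> reduced u \<and>
     (u = [] \<or> hd u \<noteq> (if l = Pos Beta then Pos Beta else inv_letter l))"
  by (auto simp: reduced_def successively_Cons)

text \<open>Flipping interchanges the two forbidden factors in \<alpha> and preserves the factor
  \<open>\<beta>\<beta>\<close>.\<close>

lemma reduced_flip: "reduced u \<Longrightarrow> reduced (map flip_letter u)"
proof (induction u)
  case (Cons l u)
  show ?case
  proof (cases u)
    case Nil
    with Cons.prems show ?thesis
      by (cases l rule: letter_cases) (simp_all add: reduced_def)
  next
    case (Cons m v)
    with Cons.IH Cons.prems show ?thesis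
      by (cases l rule: letter_cases; cases m rule: letter_cases) (simp_all add: reduced_Cons)
  qed
qed simp

lemma reduced_nf_beta: "reduced (fst p) \<Longrightarrow> reduced (fst (nf_beta p))"
  by (cases p rule: nf_beta.cases) (simp_all add: reduced_Cons reduced_flip)

lemma reduced_nf_cons: "reduced (fst p) \<Longrightarrow> reduced (fst (nf_cons l p))"
proof (cases "(l, p)" rule: nf_cons.cases)
qed (simp_all add: reduced_Cons reduced_flip reduced_nf_beta)

lemma reduced_normal_form: "reduced (fst (normal_form w))"
  unfolding normal_form_def
  by (induction w) (simp_all add: reduced_nf_cons, simp add: reduced_def)

lemma relators_eq:
  "relators = {word_class [Pos Beta, Pos Beta, Pos Beta, Pos Beta],
     word_class [Pos Beta, Pos Beta, Pos Alpha, Pos Beta, Pos Beta, Pos Alpha]}"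
  by (simp add: relators_def free_gen_def free_group_mult one_free_group numeral_eq_Suc Let_def
      nat_pow_def)

section \<open>Normal forms in an arbitrary group satisfying the relators\<close>

context group
begin

context
  fixes f :: "gen \<Rightarrow> 'a"
  assumes f: "f x \<in> carrier G"
    and beta4: "word_eval G f [Pos Beta, Pos Beta, Pos Beta, Pos Beta] = \<one>"
    and flip: "word_eval G f [Pos Beta, Pos Beta, Pos Alpha, Pos Beta, Pos Beta, Pos Alpha] = \<one>"
begin

private abbreviation "a \<equiv> f Alpha"
private abbreviation "b \<equiv> f Beta"
private abbreviation "c \<equiv> b \<otimes> b"
private abbreviation "ev \<equiv> word_eval G f"

lemma c_mult_c: "c \<otimes> c = \<one>"
  using beta4 by (simp add: f m_assoc)

text \<open>The second relator makes \<open>c \<otimes> a\<close> its own inverse, and the first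
  does the same for \<open>c\<close>.\<close>

lemma c_mult_a: "c \<otimes> a = inv a \<otimes> c"
proof -
  have "(c \<otimes> a) \<otimes> (c \<otimes> a) = \<one>"
    using flip by (simp add: f m_assoc)
  then have "c \<otimes> a = inv (c \<otimes> a)"
    by (simp add: f inv_equality)
  also have "\<dots> = inv a \<otimes> inv c"
    by (simp add: f inv_mult_group)
  also have "inv c = c"
    by (rule inv_equality) (simp_all add: f c_mult_c)
  finally show ?thesis .
qed

lemma c_mult_inv_a: "c \<otimes> inv a = a \<otimes> c"
proof -
  have "c \<otimes> inv a = a \<otimes> (inv a \<otimes> c) \<otimes> inv a"
    by (simp add: f flip: m_assoc)
  also have "\<dots> = a \<otimes> (c \<otimes> a) \<otimes> inv a"
    by (simp only: c_mult_a)
  also have "\<dots> = a \<otimes> c"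
    by (simp add: f m_assoc)
  finally show ?thesis .
qed

lemma c_mult_inv_b: "c \<otimes> inv b = inv b \<otimes> c"
  by (simp add: f m_assoc) (simp add: f flip: m_assoc)

lemma c_mult_letter_eval: "c \<otimes> letter_eval G f l = letter_eval G f (flip_letter l) \<otimes> c"
  by (cases l rule: letter_cases)
    (simp_all add: c_mult_a c_mult_inv_a c_mult_inv_b, simp add: f m_assoc)

lemma c_mult_word_eval: "c \<otimes> ev u = ev (map flip_letter u) \<otimes> c"
proof (induction u)
  case (Cons l u)
  have "c \<otimes> ev (l # u) = (c \<otimes> letter_eval G f l) \<otimes> ev u"
    by (simp add: f letter_eval_closed word_eval_closed m_assoc)
  also have "\<dots> = letter_eval G f (flip_letter l) \<otimes> (c \<otimes> ev u)"
    by (simp add: c_mult_letter_eval f letter_eval_closed word_eval_closed m_assoc)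
  finally show ?case
    by (simp add: Cons f letter_eval_closed word_eval_closed m_assoc)
qed (simp add: f)

private lemma eval_nf_word: "ev (nf_word (u, e)) = ev u \<otimes> (if e then c else \<one>)"
  by (simp add: nf_word_def word_eval_append word_eval_closed f)

private lemma eval_nf_flip: "ev (nf_word (map flip_letter u, \<not> e)) = c \<otimes> ev (nf_word (u, e))"
proof -
  have "c \<otimes> ev (nf_word (u, e)) = (c \<otimes> ev u) \<otimes> (if e then c else \<one>)"
    by (simp add: eval_nf_word word_eval_closed f m_assoc)
  also have "\<dots> = ev (map flip_letter u) \<otimes> (c \<otimes> (if e then c else \<one>))"
    by (simp add: c_mult_word_eval word_eval_closed f m_assoc)
  finally show ?thesis
    by (simp add: eval_nf_word c_mult_c f)
qed

private lemma eval_nf_Cons: "ev (nf_word (l # u, e)) = letter_eval G f l \<otimes> ev (nf_word (u, e))"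
  by (simp add: nf_word_def)

private lemma eval_nf_beta: "ev (nf_word (nf_beta p)) = b \<otimes> ev (nf_word p)"
  by (cases p rule: nf_beta.cases)
    (simp_all add: eval_nf_flip eval_nf_Cons word_eval_closed f m_assoc)

private lemma eval_nf_cons: "ev (nf_word (nf_cons l p)) = letter_eval G f l \<otimes> ev (nf_word p)"
proof -
  \<comment> \<open>The fourth power of \<open>b\<close> is trivial, so its cube is
    \<open>inv b\<close>; this is the \<open>Neg Beta\<close> clause of
    \<open>nf_cons\<close>.\<close>
  have "b \<otimes> (c \<otimes> x) = inv b \<otimes> x" if "x \<in> carrier G" for x
  proof -
    have "b \<otimes> c = inv b"
      using c_mult_c by (intro inv_equality[symmetric]) (simp_all add: f m_assoc)
    with that show ?thesis by (simp add: f flip: m_assoc)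
  qed
  moreover have "x = a \<otimes> (inv a \<otimes> x)" "x = inv a \<otimes> (a \<otimes> x)" if "x \<in> carrier G" for x
    using that by (simp_all add: f flip: m_assoc)
  ultimately show ?thesis
    by (cases "(l, p)" rule: nf_cons.cases)
      (auto simp: eval_nf_Cons eval_nf_beta eval_nf_flip word_eval_closed f)
qed

text \<open>Each \<open>nf_cons\<close> realizes left multiplication by its letter. The result
  serves both quotients of the free group and \<open>SO3\<close>.\<close>

lemma word_eval_normal_form: "word_eval G f (nf_word (normal_form w)) = word_eval G f w"
  by (induction w) (simp_all add: normal_form_def eval_nf_cons, simp add: nf_word_def)

end

end

text \<open>Modulo any normal subgroup containing the relators, a word equals its normal form, here
  the identity.\<close>

lemma word_class_in_normal_closure_relators:
  assumes "normal_form w = ([], False)"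
  shows "word_class w \<in> normal_closure free_group relators"
proof -
  have "word_class w \<in> N" if N: "N \<lhd> free_group" and "relators \<subseteq> N" for N
  proof -
    interpret normal N free_group by (fact N)
    let ?Q = "free_group Mod N" and ?f = "\<lambda>x. N #>\<^bsub>free_group\<^esub> free_gen x"
    interpret Q: group ?Q by (fact factorgroup_is_group)
    have hom: "group_hom free_group ?Q (\<lambda>x. N #>\<^bsub>free_group\<^esub> x)"
      by (simp add: group_hom_def group_hom_axioms_def r_coset_hom_Mod Q.is_group group_free_group)
    have eval: "word_eval ?Q ?f v = N #>\<^bsub>free_group\<^esub> word_class v" for v
      using hom_word_eval[OF hom, of free_gen, OF free_gen_closed, of v]
      by (simp add: word_eval_free_gen)
    have closed: "?f x \<in> carrier ?Q" for x
      by (rule group_hom.hom_closed[OF hom free_gen_closed])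
    have relator: "word_eval ?Q ?f v = \<one>\<^bsub>?Q\<^esub>" if "word_class v \<in> relators" for v
      using that \<open>relators \<subseteq> N\<close> coset_join2[OF word_class_closed is_subgroup]
      by (auto simp: eval)
    have "word_eval ?Q ?f (nf_word (normal_form w)) = word_eval ?Q ?f w"
      by (intro Q.word_eval_normal_form closed relator) (simp_all add: relators_eq)
    then have "N #>\<^bsub>free_group\<^esub> word_class w = N"
      using assms by (simp add: eval nf_word_def flip: one_free_group)
    then show ?thesis
      using coset_join1 word_class_closed is_subgroup by blast
  qed
  then show ?thesis by (simp add: normal_closure_def)
qed

section \<open>The rotations\<close>

lemma SO3_simps [simp]:
  "carrier SO3 = {A. rotation_matrix A}" "x \<otimes>\<^bsub>SO3\<^esub> y = x ** y" "\<one>\<^bsub>SO3\<^esub> = mat 1"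
  by (simp_all add: SO3_def)

text \<open>Double-angle formulas; the common denominator 5 makes \<open>5 T\<close>
  integral.\<close>

lemma cos_sin_angle: "cos (2 * arctan (1/2)) = 3/5" "sin (2 * arctan (1/2)) = 4/5"
proof -
  have "1 + (1/2)\<^sup>2 = (5/4 :: real)" by (simp add: power2_eq_square)
  then show "cos (2 * arctan (1/2)) = 3/5" "sin (2 * arctan (1/2)) = 4/5"
    by (simp_all add: cos_double sin_double cos_arctan sin_arctan power_divide real_sqrt_divide)
qed

lemma inv_rot_x: "inv\<^bsub>SO3\<^esub> (rot_x t) = rot_x (- t)"
proof (rule group.inv_equality[OF group_SO3])
  show "rot_x (- t) \<otimes>\<^bsub>SO3\<^esub> rot_x t = \<one>\<^bsub>SO3\<^esub>"
    by (simp add: rot_x_def vec_eq_iff forall_3 matrix_matrix_mult_def mat_def sum_3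
        flip: power2_eq_square)
qed (simp_all add: rotation_matrix_rot_x)

lemma rot_x_mult_vec:
  "rot_x t *v vector [x, y, z] = vector [x, cos t * y - sin t * z, sin t * y + cos t * z]"
  by (simp add: rot_x_def vec_eq_iff forall_3 matrix_vector_mult_def sum_3)

lemma rot_y_mult_vec: "rot_y (pi/2) *v vector [x, y, z] = vector [z, y, - x]"
  by (simp add: rot_y_def vec_eq_iff forall_3 matrix_vector_mult_def sum_3)

lemma scaleR_vector_3: "c *\<^sub>R (vector [x, y, z] :: real^3) = vector [c * x, c * y, c * z]"
  by (simp add: vec_eq_iff forall_3)

definition rot :: "gen \<Rightarrow> real^3^3" where
  "rot x = (case x of Alpha \<Rightarrow> rot_x (2 * arctan (1/2)) | Beta \<Rightarrow> rot_y (pi/2))"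

lemma rot_closed: "rot x \<in> carrier SO3"
  by (cases x) (simp_all add: rot_def rotation_matrix_rot_x rotation_matrix_rot_y)

lemma rot_relators:
  "word_eval SO3 rot [Pos Beta, Pos Beta, Pos Beta, Pos Beta] = \<one>\<^bsub>SO3\<^esub>"
  "word_eval SO3 rot [Pos Beta, Pos Beta, Pos Alpha, Pos Beta, Pos Beta, Pos Alpha] = \<one>\<^bsub>SO3\<^esub>"
  by (simp_all add: rot_def rot_x_def rot_y_def cos_sin_angle vec_eq_iff forall_3
      matrix_matrix_mult_def mat_def sum_3)

section \<open>Action of reduced words on the y-axis modulo 5\<close>

definition alpha_count :: "gen letter list \<Rightarrow> nat" where
  "alpha_count u = length (filter (\<lambda>l. l \<noteq> Pos Beta) u)"

text \<open>Modulo 5 the matrices \<open>5 T\<close> and \<open>5 T\<inverse>\<close> have rank one, with images spanned by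
  \<open>(0, 1, 3)\<close> and \<open>(0, 1, 2)\<close>; the condition records on which of these lines, or on which of their
  translates by \<open>S\<close>, a reduced word sends \<open>(0, 1, 0)\<close>.\<close>

fun line_mod_5 :: "gen letter list \<Rightarrow> int \<Rightarrow> int \<Rightarrow> int \<Rightarrow> bool" where
  "line_mod_5 [] x y z \<longleftrightarrow> 5 dvd x \<and> 5 dvd z"
| "line_mod_5 (Pos Alpha # u) x y z \<longleftrightarrow> 5 dvd x \<and> 5 dvd z - 3 * y"
| "line_mod_5 (Neg Alpha # u) x y z \<longleftrightarrow> 5 dvd x \<and> 5 dvd z - 2 * y"
| "line_mod_5 (l # u) x y z \<longleftrightarrow> 5 dvd z"

text \<open>Modulo 5, z = 0 yields 3y and z = 3y yields y. The value z = 2y, which would yield 0,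
  belongs to a leading \<open>Neg Alpha\<close>, excluded by reducedness.\<close>

lemma line_mod_5_Pos_Alpha:
  assumes "line_mod_5 u x y z" "reduced (Pos Alpha # u)" "\<not> 5 dvd y"
  shows "\<not> 5 dvd 3 * y - 4 * z"
proof -
  have "5 dvd z \<or> 5 dvd z - 3 * y"
    using assms(1,2) by (cases "(u, x, y, z)" rule: line_mod_5.cases) (simp_all add: reduced_Cons)
  with assms(3) show ?thesis by presburger
qed

lemma line_mod_5_Neg_Alpha:
  assumes "line_mod_5 u x y z" "reduced (Neg Alpha # u)" "\<not> 5 dvd y"
  shows "\<not> 5 dvd 3 * y + 4 * z"
proof -
  have "5 dvd z \<or> 5 dvd z - 2 * y"
    using assms(1,2) by (cases "(u, x, y, z)" rule: line_mod_5.cases) (simp_all add: reduced_Cons)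
  with assms(3) show ?thesis by presburger
qed

text \<open>Reducedness rules out a second leading \<open>Pos Beta\<close>, the only case leaving x
  unconstrained.\<close>

lemma line_mod_5_Pos_Beta:
  assumes "line_mod_5 u x y z" "reduced (Pos Beta # u)"
  shows "5 dvd x"
  using assms by (cases "(u, x, y, z)" rule: line_mod_5.cases) (simp_all add: reduced_Cons)

text \<open>A prepended letter acts last: each \<alpha> letter costs a factor 5, while \<beta> only
  permutes coordinates up to sign. Knowing the line of the previous vector keeps y nonzero modulo
  5.\<close>

lemma word_eval_rot_mod_5:
  assumes "reduced u"
  obtains x y z :: int where
    "5 ^ alpha_count u *\<^sub>R (word_eval SO3 rot u *v vector [0, 1, 0]) = vector [real_of_int x, real_of_int y, real_of_int z]"
    "\<not> 5 dvd y" "line_mod_5 u x y z"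
  using assms
proof (induction u arbitrary: thesis)
  case Nil
  show ?case
    by (rule Nil.prems(1)[of 0 1 0]) (simp_all add: alpha_count_def)
next
  case (Cons l u)
  from Cons.prems(2) have "reduced u" by (simp add: reduced_Cons)
  then obtain x y z :: int where
    v: "5 ^ alpha_count u *\<^sub>R (word_eval SO3 rot u *v vector [0, 1, 0]) = vector [real_of_int x, real_of_int y, real_of_int z]"
    and y: "\<not> 5 dvd y" and line: "line_mod_5 u x y z"
    using Cons.IH by blast
  let ?w = "letter_eval SO3 rot l *v vector [real_of_int x, real_of_int y, real_of_int z]"
  have step: "5 ^ alpha_count u *\<^sub>R (word_eval SO3 rot (l # u) *v vector [0, 1, 0]) = ?w"
    by (simp add: v[symmetric] matrix_vector_mult_scaleR flip: matrix_vector_mul_assoc)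
  have step5: "5 ^ alpha_count (l # u) *\<^sub>R (word_eval SO3 rot (l # u) *v vector [0, 1, 0]) = 5 *\<^sub>R ?w"
    if "l \<noteq> Pos Beta"
    unfolding step[symmetric] using that by (simp add: alpha_count_def)
  consider "l = Pos Alpha" | "l = Neg Alpha" | "l = Pos Beta"
    using Cons.prems(2) by (cases l rule: letter_cases) (simp_all add: reduced_Cons)
  then show ?case
  proof cases
    case 1
    have "5 *\<^sub>R ?w = vector [real_of_int (5 * x), real_of_int (3 * y - 4 * z), real_of_int (4 * y + 3 * z)]"
      by (simp add: 1 rot_def rot_x_mult_vec cos_sin_angle scaleR_vector_3 algebra_simps)
    \<comment> \<open>The new vector lies modulo 5 on the line through (0, 1, 3), whatever y and z
      are.\<close>
    moreover have "5 dvd (4 * y + 3 * z) - 3 * (3 * y - 4 * z)" by presburger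
    ultimately show ?thesis
      using Cons.prems(1)[of "5 * x" "3 * y - 4 * z" "4 * y + 3 * z"] step5
        line_mod_5_Pos_Alpha[OF line _ y] Cons.prems(2)
      unfolding 1 by simp
  next
    case 2
    have "5 *\<^sub>R ?w = vector [real_of_int (5 * x), real_of_int (3 * y + 4 * z), real_of_int (3 * z - 4 * y)]"
      by (simp add: 2 rot_def inv_rot_x rot_x_mult_vec cos_sin_angle scaleR_vector_3 algebra_simps)
    moreover have "5 dvd (3 * z - 4 * y) - 2 * (3 * y + 4 * z)" by presburger
    ultimately show ?thesis
      using Cons.prems(1)[of "5 * x" "3 * y + 4 * z" "3 * z - 4 * y"] step5
        line_mod_5_Neg_Alpha[OF line _ y] Cons.prems(2)
      unfolding 2 by simp
  next
    case 3
    have "?w = vector [real_of_int z, real_of_int y, real_of_int (- x)]"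
      by (simp add: 3 rot_def rot_y_mult_vec)
    with step have eq: "5 ^ alpha_count (l # u) *\<^sub>R (word_eval SO3 rot (l # u) *v vector [0, 1, 0]) = \<dots>"
      by (simp add: 3 alpha_count_def)
    have "5 dvd x"
      using line_mod_5_Pos_Beta[OF line] Cons.prems(2) 3 by blast
    then show ?thesis
      by (intro Cons.prems(1)[OF eq y]) (simp add: 3)
  qed
qed

text \<open>Only letters \<beta> remain, and no two of them may be adjacent.\<close>

lemma alpha_count_eq_0:
  assumes "reduced u" "alpha_count u = 0"
  shows "u = [] \<or> u = [Pos Beta]"
proof (cases u)
  case (Cons l v)
  with assms show ?thesis
    by (cases v) (auto simp: alpha_count_def reduced_Cons split: if_splits)
qed simp

lemma word_eval_rot_eq_one:
  assumes "reduced u" and one: "word_eval SO3 rot (nf_word (u, e)) = \<one>\<^bsub>SO3\<^esub>"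
  shows "u = [] \<and> \<not> e"
proof -
  \<comment> \<open>A final \<open>\<beta>\<^sup>2\<close> acts as a half-turn about the y-axis, so
    the flag is invisible on this vector.\<close>
  have "word_eval SO3 rot (nf_word (u, e)) *v vector [0, 1, 0] = word_eval SO3 rot u *v vector [0, 1, 0]"
    by (simp add: nf_word_def group.word_eval_append[OF group_SO3, of rot, OF rot_closed] rot_def rot_y_mult_vec
        flip: matrix_vector_mul_assoc)
  with one have "word_eval SO3 rot u *v vector [0, 1, 0] = vector [0, 1, 0]" by simp
  moreover obtain x y z :: int where
    "5 ^ alpha_count u *\<^sub>R (word_eval SO3 rot u *v vector [0, 1, 0]) = vector [real_of_int x, real_of_int y, real_of_int z]"
    and y: "\<not> 5 dvd y"
    using word_eval_rot_mod_5[OF assms(1)] by blast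
  ultimately have "real_of_int (5 ^ alpha_count u) = real_of_int y"
    by (simp add: scaleR_vector_3 vec_eq_iff forall_3)
  then have "y = 5 ^ alpha_count u" by linarith
  with y have "alpha_count u = 0" by (cases "alpha_count u") auto
  then have u: "u = [] \<or> u = [Pos Beta]"
    by (rule alpha_count_eq_0[OF assms(1)])
  \<comment> \<open>Four candidates remain, the powers of S with exponents 0 to 3; their upper left
    entries are 1, 0, -1, 0.\<close>
  have "word_eval SO3 rot (nf_word (u, e)) $ 1 $ 1 = 1"
    by (simp add: one mat_def)
  with u show ?thesis
    by (cases e) (auto simp: nf_word_def rot_def rot_y_def matrix_matrix_mult_def mat_def sum_3)
qed

theorem theorem4:
  fixes \<nu> :: real and T S :: "real^3^3"
  assumes "\<nu> = 2 * arctan (1/2)"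
    and "T = rot_x \<nu>"
    and "S = rot_y (pi/2)"
  shows "\<exists>h \<in> iso (presented_group relators) (subgroup_generated SO3 {T, S}).
           h (presented_gen relators Alpha) = T \<and> h (presented_gen relators Beta) = S"
proof -
  have T: "rot Alpha = T" and S: "rot Beta = S"
    using assms by (simp_all add: rot_def)
  have UNIV_gen: "UNIV = {Alpha, Beta}"
    using gen.exhaust by auto
  have range: "range rot = {T, S}"
    unfolding UNIV_gen by (simp add: T S)
  have "\<exists>h \<in> iso (presented_group relators) (subgroup_generated SO3 (range rot)).
      \<forall>x. h (presented_gen relators x) = rot x"
  proof (rule presentation_iso[OF group_SO3, of rot, OF rot_closed])
    fix w
    have "word_eval SO3 rot w = \<one>\<^bsub>SO3\<^esub>"
      if "word_class w = word_class v" "word_eval SO3 rot v = \<one>\<^bsub>SO3\<^esub>" for v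
      using that group.word_eval_free_eq[OF group_SO3, of rot, OF rot_closed]
      unfolding word_class_eq_iff by metis
    then show "word_class w \<in> relators \<Longrightarrow> word_eval SO3 rot w = \<one>\<^bsub>SO3\<^esub>"
      unfolding relators_eq using rot_relators by blast
    show "relators \<subseteq> carrier free_group"
      by (simp add: relators_eq word_class_closed)
    \<comment> \<open>Faithfulness: the normal form also evaluates to the identity, and being
      reduced it must be trivial.\<close>
    assume "word_eval SO3 rot w = \<one>\<^bsub>SO3\<^esub>"
    then have "word_eval SO3 rot (nf_word (normal_form w)) = \<one>\<^bsub>SO3\<^esub>"
      using group.word_eval_normal_form[OF group_SO3, of rot, OF rot_closed rot_relators] by simp
    then have "normal_form w = ([], False)"
      using word_eval_rot_eq_one[OF reduced_normal_form, of w "snd (normal_form w)"]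
      by (simp add: prod_eq_iff)
    then show "word_class w \<in> normal_closure free_group relators"
      by (rule word_class_in_normal_closure_relators)
  qed
  then show ?thesis
    unfolding range T[symmetric] S[symmetric] by blast
qed

end
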